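(* Let $N,k\in\mathbb N$ and $\tau>0$, and let $U\sim\mathrm U(N)$ denote the Haar measure. Then the query complexity of non-trivial learning states $\rho(U)=U|0\rangle\langle0|U^\dagger$ with respect to $U\sim\mathrm U(N)$ from $k$-copy quantum statistical queries satisfies $$q_{\mathrm{nt}}\big[(\mathbb S^{N-1})^{\odot k},\tau\big]\ge\exp\left(\frac{N\tau^2}{9\pi^3k^2}\right).$$
   Context: The $k$-copy oracle $\mathtt{QStat}^{(k)}_\tau(\rho)$, queried with a Hermitian $O$ on $(\mathbb C^N)^{\otimes k}$ with $\|O\|_{\mathrm{op}}\le1$, returns some $v$ with $|v-\mathrm{tr}[\rho^{\otimes k}O]|\le\tau$. The query complexity of non-trivial learning is $q_{\mathrm{nt}}[(\mathbb S^{N-1})^{\odot k},\tau]=\sup_g\big(\sup_O\Pr_{U\sim\mathrm U(N)}[|\mathrm{tr}[\rho(U)^{\otimes k}O]-g(O)|>\tau]\big)^{-1}$, where $O$ ranges over Hermitian operators on $(\mathbb C^N)^{\otimes k}$ with $\|O\|_{\mathrm{op}}\le1$ and $g$ over real-valued functions on that set. *)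

theory Defs
  imports "HOL-Probability.Probability"
begin

definition cadj :: "complex^'n^'n \<Rightarrow> complex^'n^'n" where
  "cadj U = (\<chi> i j. cnj (U $ j $ i))"

definition unitary_mat :: "complex^'n^'n \<Rightarrow> bool" where
  "unitary_mat U \<longleftrightarrow> U ** cadj U = mat 1 \<and> cadj U ** U = mat 1"

text \<open>Haar probability measure on U(N): a Borel probability measure on matrices,
  concentrated on the unitary group, invariant under left multiplication by unitaries.
  (Such a measure exists and is unique.)\<close>
definition haar_unitary :: "(complex^'n^'n) measure \<Rightarrow> bool" where
  "haar_unitary \<mu> \<longleftrightarrow> prob_space \<mu> \<and> sets \<mu> = sets borel \<and>
     measure \<mu> {U. unitary_mat U} = 1 \<and>
     (\<forall>V. unitary_mat V \<longrightarrow> distr \<mu> \<mu> (\<lambda>U. V ** U) = \<mu>)"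

text \<open>Basis of (C^N)^{\<otimes>k}: words of length k over 'n.\<close>
definition tidx :: "nat \<Rightarrow> 'n list set" where
  "tidx k = {xs. length xs = k}"

type_synonym 'n kop = "'n list \<Rightarrow> 'n list \<Rightarrow> complex"

definition apply_op :: "nat \<Rightarrow> 'n kop \<Rightarrow> ('n list \<Rightarrow> complex) \<Rightarrow> 'n list \<Rightarrow> complex" where
  "apply_op k Q v = (\<lambda>xs. \<Sum>ys\<in>tidx k. Q xs ys * v ys)"

definition hermitian_op :: "nat \<Rightarrow> 'n kop \<Rightarrow> bool" where
  "hermitian_op k Q \<longleftrightarrow> (\<forall>xs\<in>tidx k. \<forall>ys\<in>tidx k. Q xs ys = cnj (Q ys xs))"

definition opnorm_le1 :: "nat \<Rightarrow> 'n kop \<Rightarrow> bool" where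
  "opnorm_le1 k Q \<longleftrightarrow> (\<forall>v. (\<Sum>xs\<in>tidx k. (cmod (apply_op k Q v xs))\<^sup>2)
                              \<le> (\<Sum>xs\<in>tidx k. (cmod (v xs))\<^sup>2))"

definition obs :: "nat \<Rightarrow> 'n kop set" where
  "obs k = {Q. hermitian_op k Q \<and> opnorm_le1 k Q}"

definition rho :: "'n \<Rightarrow> complex^'n^'n \<Rightarrow> 'n \<Rightarrow> 'n \<Rightarrow> complex" where
  "rho i0 U = (\<lambda>a b. U $ a $ i0 * cnj (U $ b $ i0))"

definition tensor_pow :: "nat \<Rightarrow> ('n \<Rightarrow> 'n \<Rightarrow> complex) \<Rightarrow> 'n kop" where
  "tensor_pow k A = (\<lambda>xs ys. \<Prod>i<k. A (xs ! i) (ys ! i))"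

definition tr_prod :: "nat \<Rightarrow> 'n kop \<Rightarrow> 'n kop \<Rightarrow> complex" where
  "tr_prod k A Q = (\<Sum>xs\<in>tidx k. \<Sum>ys\<in>tidx k. A xs ys * Q ys xs)"

text \<open>Query complexity of non-trivial learning (inverse of 0 is infinity in ennreal).\<close>
definition q_nt :: "(complex^'n^'n) measure \<Rightarrow> 'n \<Rightarrow> nat \<Rightarrow> real \<Rightarrow> ennreal" where
  "q_nt \<mu> i0 k \<tau> = (SUP g :: 'n kop \<Rightarrow> real. inverse (SUP Q\<in>obs k.
      emeasure \<mu> {U\<in>space \<mu>. cmod (tr_prod k (tensor_pow k (rho i0 U)) Q - complex_of_real (g Q)) > \<tau>}))"

end

theory Submission
  imports Defs
begin

text \<open>For an observable \<open>Q\<close> the function \<open>f v = \<langle>v\<^sup>\<otimes>\<^sup>k|Q|v\<^sup>\<otimes>\<^sup>k\<rangle>\<close> ignores phases, and its derivative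
  at a unit vector has norm at most \<open>L = 2k\<close>. If \<open>(a, b)\<close> is an orthonormal pair and \<open>U\<close> is Haar
  distributed, then the derivative of \<open>f\<close> at \<open>U a\<close> in direction \<open>U b\<close> has the law of a random sign
  combination of its partial derivatives in \<open>N - 1\<close> orthonormal directions, so it is subgaussian with
  variance proxy \<open>L\<^sup>2 / (N - 1)\<close>. Up to a phase, any two unit vectors lie on an arc of length at most
  \<open>\<pi>/2\<close> of a great circle spanned by an orthonormal pair; each point of it forms an orthonormal pair
  with its tangent. Integrating along the arc, with Jensen's inequality for \<open>exp\<close>, shows that
  \<open>f (U w) - f (U v)\<close>, and hence the difference of two independent copies of \<open>f (U v)\<close>, is subgaussian
  with variance proxy \<open>\<pi>\<^sup>2L\<^sup>2 / (2N)\<close>. This gives a center \<open>c\<close> with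
  \<open>P(|f (U v) - c| > t) \<le> 2 exp(- \<kappa> t\<^sup>2)\<close>, where \<open>\<kappa> = N / (\<pi>\<^sup>2L\<^sup>2)\<close>.

  The factor \<open>2\<close> is removed at the cost of a factor \<open>6\<close> in the exponent, which \<open>9\<pi>\<^sup>3 \<ge> 24\<pi>\<^sup>2\<close> allows:
  it is absorbed by the exponential if \<open>\<kappa> t\<^sup>2 \<ge> 1\<close>, and otherwise an interval of radius \<open>2 / \<surd>\<kappa>\<close>
  carries at least half of the mass, so that by the pigeonhole principle some interval of radius \<open>t\<close>
  carries enough.\<close>

section \<open>Unitary matrices\<close>

definition cinner :: "complex^'n \<Rightarrow> complex^'n \<Rightarrow> complex" where
  "cinner x y = (\<Sum>i\<in>UNIV. cnj (x $ i) * y $ i)"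

lemma cinner_self: "cinner x x = of_real ((norm x)\<^sup>2)"
  unfolding cinner_def norm_vec_def L2_set_def
  by (simp add: sum_nonneg complex_norm_square mult.commute del: of_real_power)

lemma norm_eq_1_iff_cinner: "norm x = 1 \<longleftrightarrow> cinner x x = 1"
  by (simp add: cinner_self abs_square_eq_1 flip: of_real_power)

lemma Re_cinner: "Re (cinner x y) = x \<bullet> y"
  by (simp add: cinner_def inner_vec_def inner_complex_def)

lemma norm_vector_scalar_mult: "norm (c *s x) = cmod c * norm x" for x :: "complex^'n"
  by (simp add: norm_vec_def norm_mult L2_set_right_distrib)

lemma cnj_cinner: "cnj (cinner x y) = cinner y x"
  by (simp add: cinner_def mult.commute)

lemma cinner_add_left: "cinner (x + y) z = cinner x z + cinner y z"
  and cinner_add_right: "cinner z (x + y) = cinner z x + cinner z y"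
  and cinner_diff_left: "cinner (x - y) z = cinner x z - cinner y z"
  and cinner_diff_right: "cinner z (x - y) = cinner z x - cinner z y"
  by (simp_all add: cinner_def algebra_simps sum.distrib sum_subtractf)

lemma cinner_scale_right: "cinner x (c *s y) = c * cinner x y"
  by (simp add: cinner_def sum_distrib_left mult_ac)

lemma cinner_scaleR_left: "cinner (r *\<^sub>R x) y = of_real r * cinner x y"
  and cinner_scaleR_right: "cinner x (r *\<^sub>R y) = of_real r * cinner x y"
  by (simp_all add: cinner_def sum_distrib_left scaleR_conv_of_real[where 'a=complex] mult_ac)

lemma cinner_axis_left: "cinner (axis i 1) x = x $ i"
  by (simp add: cinner_def axis_def if_distrib[of cnj] if_distrib[of "\<lambda>x. x * _"] cong: if_cong)

lemma norm_axis_complex: "norm (axis i 1 :: complex^'n) = 1"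
  by (simp add: norm_eq_1_iff_cinner cinner_axis_left)

lemma cinner_matrix_vector_mult_left: "cinner (A *v x) y = cinner x (cadj A *v y)"
  by (simp add: cinner_def cadj_def matrix_vector_mult_def sum_distrib_left sum_distrib_right mult_ac)
     (rule sum.swap)

lemma cadj_cadj [simp]: "cadj (cadj A) = A"
  by (simp add: cadj_def)

lemma cadj_matrix_mult: "cadj (A ** B) = cadj B ** cadj A"
  by (simp add: cadj_def matrix_matrix_mult_def mult.commute)

lemma unitary_mat_cadj: "unitary_mat U \<Longrightarrow> unitary_mat (cadj U)"
  by (auto simp: unitary_mat_def)

lemma unitary_mat_matrix_mult:
  assumes "unitary_mat U" "unitary_mat V"
  shows "unitary_mat (U ** V)"
proof -
  have "(U ** V) ** (cadj V ** cadj U) = U ** (V ** cadj V) ** cadj U"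
    and "(cadj V ** cadj U) ** (U ** V) = cadj V ** (cadj U ** U) ** V"
    by (simp_all add: matrix_mul_assoc)
  then show ?thesis
    using assms by (simp add: unitary_mat_def cadj_matrix_mult)
qed

lemma cinner_unitary_mat: "unitary_mat U \<Longrightarrow> cinner (U *v x) (U *v y) = cinner x y"
  by (simp add: cinner_matrix_vector_mult_left matrix_vector_mul_assoc unitary_mat_def)

lemma norm_unitary_mat: "unitary_mat U \<Longrightarrow> norm (U *v x) = norm x"
  using cinner_unitary_mat[of U x x] by (simp add: cinner_self flip: of_real_power)

definition complex_reflection :: "complex \<Rightarrow> complex^'n \<Rightarrow> complex^'n^'n" where
  "complex_reflection b v = (\<chi> i j. (if i = j then 1 else 0) - b * v $ i * cnj (v $ j))"

lemma complex_reflection_mult_vec: "complex_reflection b v *v x = x - (b * cinner v x) *s v"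
  by (simp add: vec_eq_iff complex_reflection_def matrix_vector_mult_def cinner_def algebra_simps
      sum_subtractf sum_distrib_left if_distrib[of "\<lambda>x. _ * x"] cong: if_cong)

lemma cadj_complex_reflection: "cadj (complex_reflection b v) = complex_reflection (cnj b) v"
  by (simp add: complex_reflection_def cadj_def vec_eq_iff)

lemma complex_reflection_inverse:
  assumes "a + b = a * b * cinner v v"
  shows "complex_reflection a v ** complex_reflection b v = mat 1"
proof -
  have "complex_reflection a v *v (complex_reflection b v *v x)
      = x - ((a + b - a * b * cinner v v) * cinner v x) *s v" for x
    by (simp add: complex_reflection_mult_vec cinner_diff_right cinner_scale_right vec_eq_iff algebra_simps)
  then show ?thesis
    using assms by (simp add: matrix_eq matrix_vector_mul_assoc)
qed

lemma unitary_mat_complex_reflection: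
  assumes "b + cnj b = b * cnj b * cinner v v"
  shows "unitary_mat (complex_reflection b v)"
  using assms unfolding unitary_mat_def cadj_complex_reflection
  by (auto intro!: complex_reflection_inverse simp: add.commute mult.commute)

lemma exists_unitary_map_vector:
  fixes x y :: "complex^'n"
  assumes "norm x = norm y"
  obtains R where "unitary_mat R" "R *v x = y" "\<And>z. cinner (x - y) z = 0 \<Longrightarrow> R *v z = z"
proof -
  define v where "v = x - y"
  \<comment> \<open>If \<open>x = y\<close>, then \<open>b = 1 / 0 = 0\<close> and the reflection is the identity.\<close>
  define b where "b = 1 / cinner v x"
  have "cinner x x = cinner y y"
    using assms by (simp add: cinner_self)
  then have self: "cinner v v = cinner v x + cnj (cinner v x)"
    by (simp add: cnj_cinner v_def cinner_diff_left cinner_diff_right)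
  have "b + cnj b = b * cnj b * cinner v v"
    by (cases "cinner v x = 0") (simp_all add: self b_def field_simps)
  then have "unitary_mat (complex_reflection b v)"
    by (rule unitary_mat_complex_reflection)
  moreover have "complex_reflection b v *v x = y"
  proof (cases "cinner v x = 0")
    case True
    then have "v = 0" using self by (simp add: cinner_self)
    then show ?thesis by (simp add: complex_reflection_mult_vec) (simp add: v_def)
  next
    case False
    then show ?thesis by (simp add: complex_reflection_mult_vec b_def) (simp add: v_def)
  qed
  moreover have "complex_reflection b v *v z = z" if "cinner (x - y) z = 0" for z
    using that by (simp add: complex_reflection_mult_vec v_def)
  ultimately show ?thesis using that by blast
qed

lemma exists_unitary_map_pair:
  fixes a b a' b' :: "complex^'n"
  assumes "norm a = norm a'" "norm b = norm b'" "cinner a b = cinner a' b'"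
  obtains R where "unitary_mat R" "R *v a = a'" "R *v b = b'"
proof -
  obtain R where R: "unitary_mat R" "R *v a = a'"
    using exists_unitary_map_vector[OF assms(1)] by blast
  have "norm (R *v b) = norm b'"
    using R(1) assms(2) by (simp add: norm_unitary_mat)
  then obtain S where S: "unitary_mat S" "S *v (R *v b) = b'"
    and fixed: "\<And>z. cinner (R *v b - b') z = 0 \<Longrightarrow> S *v z = z"
    using exists_unitary_map_vector by blast
  have "cinner a' (R *v b) = cinner a' b'"
    using cinner_unitary_mat[OF R(1), of a b] R(2) assms(3) by simp
  then have "cinner (R *v b) a' = cinner b' a'"
    by (metis cnj_cinner)
  then have "S *v a' = a'"
    by (intro fixed) (simp add: cinner_diff_left)
  then show ?thesis
    using that[of "S ** R"] R S by (simp add: unitary_mat_matrix_mult flip: matrix_vector_mul_assoc)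
qed

section \<open>Orthonormal pairs and great circles\<close>

definition orthonormal_pair :: "complex^'n \<Rightarrow> complex^'n \<Rightarrow> bool" where
  "orthonormal_pair a b \<longleftrightarrow> norm a = 1 \<and> norm b = 1 \<and> cinner a b = 0"

lemma orthonormal_pair_great_circle:
  assumes "orthonormal_pair a b"
  shows "orthonormal_pair (cos t *\<^sub>R a + sin t *\<^sub>R b) (cos t *\<^sub>R b - sin t *\<^sub>R a)"
proof -
  have "cinner a a = 1" "cinner b b = 1" "cinner a b = 0" "cinner b a = 0"
    using assms cnj_cinner[of a b] by (simp_all add: orthonormal_pair_def norm_eq_1_iff_cinner)
  moreover have "complex_of_real (cos t) * of_real (cos t) + of_real (sin t) * of_real (sin t) = 1"
    by (simp only: sin_cos_squared_add3 of_real_1 flip: of_real_mult of_real_add)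
  ultimately show ?thesis
    unfolding orthonormal_pair_def norm_eq_1_iff_cinner
    by (simp add: cinner_add_left cinner_add_right cinner_diff_left cinner_diff_right
        cinner_scaleR_left cinner_scaleR_right algebra_simps)
qed

lemma card_ge_2_if_orthonormal_pair:
  fixes a b :: "complex^'n"
  assumes "orthonormal_pair a b"
  shows "CARD('n) \<ge> 2"
proof (rule ccontr)
  assume "\<not> ?thesis"
  then have "CARD('n) = 1"
    using zero_less_card_finite[where 'a='n] by linarith
  then obtain i where UNIV_eq: "(UNIV :: 'n set) = {i}"
    by (rule card_1_singletonE)
  then have "a $ i \<noteq> 0" "b $ i \<noteq> 0" "cnj (a $ i) * b $ i = 0"
    using assms unfolding orthonormal_pair_def cinner_def norm_vec_def L2_set_def UNIV_eq by auto
  then show False by simp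
qed

lemma exists_phase_cinner_eq_cmod:
  obtains c where "cmod c = 1" "cinner v (c *s w) = of_real (cmod (cinner v w))"
proof (cases "cinner v w = 0")
  case True
  then show ?thesis using that[of 1] by simp
next
  case False
  let ?z = "cinner v w"
  have "cnj (sgn ?z) * ?z = of_real (cmod ?z)"
    using False by (simp add: sgn_eq mult.commute flip: complex_norm_square) (simp add: power2_eq_square)
  then show ?thesis
    using that[of "cnj (sgn ?z)"] False by (simp add: cinner_scale_right norm_sgn)
qed

lemma exists_great_circle_arc:
  fixes v x :: "complex^'n"
  assumes norm: "norm v = 1" "norm x = 1" and cinner: "cinner v x = of_real r"
    and "0 \<le> r" "x \<noteq> v"
  obtains b \<alpha> where "orthonormal_pair v b" "0 \<le> \<alpha>" "\<alpha> \<le> pi / 2" "x = cos \<alpha> *\<^sub>R v + sin \<alpha> *\<^sub>R b"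
proof -
  define u where "u = x - r *\<^sub>R v"
  have "v \<bullet> x = r"
    using cinner by (simp flip: Re_cinner)
  then have norm_u: "(norm u)\<^sup>2 = 1 - r\<^sup>2"
    using norm unfolding u_def power2_norm_eq_inner
    by (simp add: inner_diff_left inner_diff_right inner_commute norm_eq_1 power2_eq_square)
  then have "r\<^sup>2 \<le> 1" using zero_le_power2[of "norm u"] by linarith
  then have "r \<le> 1" using \<open>0 \<le> r\<close> by (simp add: power_le_one_iff)
  have "u \<noteq> 0"
    using norm_u \<open>0 \<le> r\<close> \<open>x \<noteq> v\<close> by (auto simp: u_def power2_eq_1_iff)
  define b where "b = (1 / norm u) *\<^sub>R u"
  have "cinner v u = 0"
    using norm cinner by (simp add: u_def cinner_diff_right cinner_scaleR_right norm_eq_1_iff_cinner)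
  then have "orthonormal_pair v b"
    using norm \<open>u \<noteq> 0\<close> by (simp add: b_def orthonormal_pair_def cinner_scaleR_right)
  moreover have "0 \<le> arccos r" "arccos r \<le> pi / 2"
    using \<open>0 \<le> r\<close> \<open>r \<le> 1\<close> arccos_lbound[of r] arccos_le_pi2[of r] by linarith+
  moreover have "x = cos (arccos r) *\<^sub>R v + sin (arccos r) *\<^sub>R b"
  proof -
    have "sin (arccos r) = norm u"
      using \<open>0 \<le> r\<close> \<open>r \<le> 1\<close> by (simp add: sin_arccos flip: norm_u)
    then show ?thesis
      using \<open>u \<noteq> 0\<close> \<open>0 \<le> r\<close> \<open>r \<le> 1\<close> by (simp add: b_def u_def)
  qed
  ultimately show ?thesis by (rule that)
qed

lemma exists_great_circle_through:
  fixes v w :: "complex^'n"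
  assumes "norm v = 1" "norm w = 1"
  obtains (phase) c where "cmod c = 1" "c *s w = v"
  | (arc) c b \<alpha> where "cmod c = 1" "orthonormal_pair v b" "0 \<le> \<alpha>" "\<alpha> \<le> pi / 2"
      "c *s w = cos \<alpha> *\<^sub>R v + sin \<alpha> *\<^sub>R b"
proof -
  obtain c where "cmod c = 1" and cinner: "cinner v (c *s w) = of_real (cmod (cinner v w))"
    by (rule exists_phase_cinner_eq_cmod)
  then have "norm (c *s w) = 1"
    using assms(2) by (simp add: norm_vector_scalar_mult)
  then show ?thesis
    using exists_great_circle_arc[OF assms(1) _ cinner norm_ge_zero] \<open>cmod c = 1\<close> phase arc by metis
qed

section \<open>Subgaussian random variables\<close>

definition subgaussian :: "'a measure \<Rightarrow> real \<Rightarrow> ('a \<Rightarrow> real) \<Rightarrow> bool" where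
  "subgaussian M v X \<longleftrightarrow> X \<in> borel_measurable M \<and>
     (\<forall>l. (\<integral>\<^sup>+x. ennreal (exp (l * X x)) \<partial>M) \<le> ennreal (exp (v * l\<^sup>2 / 2)))"

lemma subgaussianI:
  assumes "X \<in> borel_measurable M"
    and "\<And>l. (\<integral>\<^sup>+x. ennreal (exp (l * X x)) \<partial>M) \<le> ennreal (exp (v * l\<^sup>2 / 2))"
  shows "subgaussian M v X"
  using assms by (simp add: subgaussian_def)

lemma borel_measurable_subgaussian: "subgaussian M v X \<Longrightarrow> X \<in> borel_measurable M"
  by (simp add: subgaussian_def)

lemma nn_integral_exp_subgaussian:
  "subgaussian M v X \<Longrightarrow> (\<integral>\<^sup>+x. ennreal (exp (l * X x)) \<partial>M) \<le> ennreal (exp (v * l\<^sup>2 / 2))"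
  by (simp add: subgaussian_def)

lemma subgaussian_mono:
  assumes "subgaussian M v X" "v \<le> w"
  shows "subgaussian M w X"
proof (rule subgaussianI)
  fix l
  have "v * l\<^sup>2 / 2 \<le> w * l\<^sup>2 / 2"
    using assms(2) by (simp add: mult_right_mono)
  then show "(\<integral>\<^sup>+x. ennreal (exp (l * X x)) \<partial>M) \<le> ennreal (exp (w * l\<^sup>2 / 2))"
    by (intro order_trans[OF nn_integral_exp_subgaussian[OF assms(1)]] ennreal_leI) simp
qed (rule borel_measurable_subgaussian[OF assms(1)])

lemma subgaussian_cmult:
  assumes "subgaussian M v X"
  shows "subgaussian M (c\<^sup>2 * v) (\<lambda>x. c * X x)"
proof (rule subgaussianI)
  show "(\<integral>\<^sup>+x. ennreal (exp (l * (c * X x))) \<partial>M) \<le> ennreal (exp (c\<^sup>2 * v * l\<^sup>2 / 2))" for l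
    using nn_integral_exp_subgaussian[OF assms, of "l * c"] by (simp add: power_mult_distrib mult_ac)
qed (use borel_measurable_subgaussian[OF assms] in measurable)

lemma (in prob_space) subgaussian_zero: "0 \<le> v \<Longrightarrow> subgaussian M v (\<lambda>_. 0)"
  by (rule subgaussianI) (simp_all add: emeasure_space_1)

lemma subgaussian_tail_ge:
  assumes X: "subgaussian M v X" and "v > 0" "t > 0"
  shows "emeasure M {x\<in>space M. t \<le> X x} \<le> ennreal (exp (- (t\<^sup>2 / (2 * v))))"
proof -
  have [measurable]: "X \<in> borel_measurable M"
    by (rule borel_measurable_subgaussian[OF X])
  define l where "l = t / v"
  have "emeasure M {x\<in>space M. t \<le> X x}
      \<le> ennreal (exp (- l * t)) * (\<integral>\<^sup>+x. ennreal (exp (l * X x)) * indicator (space M) x \<partial>M)"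
    by (rule Chernoff_ineq_nn_integral_ge) (use assms in \<open>auto simp: l_def\<close>)
  also have "(\<integral>\<^sup>+x. ennreal (exp (l * X x)) * indicator (space M) x \<partial>M) = (\<integral>\<^sup>+x. ennreal (exp (l * X x)) \<partial>M)"
    by (intro nn_integral_cong) simp
  also have "ennreal (exp (- l * t)) * \<dots> \<le> ennreal (exp (- l * t)) * ennreal (exp (v * l\<^sup>2 / 2))"
    by (intro mult_left_mono nn_integral_exp_subgaussian X) simp
  also have "\<dots> = ennreal (exp (- l * t + v * l\<^sup>2 / 2))"
    by (simp add: mult_exp_exp flip: ennreal_mult)
  also have "- l * t + v * l\<^sup>2 / 2 = - (t\<^sup>2 / (2 * v))"
    using \<open>v > 0\<close> by (simp add: l_def field_simps power2_eq_square)
  finally show ?thesis .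
qed

lemma subgaussian_tail_abs:
  assumes X: "subgaussian M v X" and "v > 0" "t > 0"
  shows "emeasure M {x\<in>space M. t < \<bar>X x\<bar>} \<le> ennreal (2 * exp (- (t\<^sup>2 / (2 * v))))"
proof -
  have [measurable]: "X \<in> borel_measurable M"
    by (rule borel_measurable_subgaussian[OF X])
  have neg: "subgaussian M v (\<lambda>x. - X x)"
    using subgaussian_cmult[OF X, of "-1"] by simp
  have "emeasure M {x\<in>space M. t < \<bar>X x\<bar>}
      \<le> emeasure M ({x\<in>space M. t \<le> X x} \<union> {x\<in>space M. t \<le> - X x})"
    by (intro emeasure_mono) (auto simp: abs_if split: if_splits)
  also have "\<dots> \<le> emeasure M {x\<in>space M. t \<le> X x} + emeasure M {x\<in>space M. t \<le> - X x}"
    by (intro emeasure_subadditive) auto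
  also have "\<dots> \<le> ennreal (exp (- (t\<^sup>2 / (2 * v)))) + ennreal (exp (- (t\<^sup>2 / (2 * v))))"
    by (intro add_mono subgaussian_tail_ge X neg assms)
  finally show ?thesis
    by (simp flip: ennreal_plus)
qed

lemma (in prob_space) exists_le_of_nn_integral_le:
  assumes [measurable]: "f \<in> borel_measurable M" and "(\<integral>\<^sup>+x. f x \<partial>M) \<le> ennreal c"
  shows "\<exists>x\<in>space M. f x \<le> ennreal c"
proof (rule ccontr)
  assume "\<not> ?thesis"
  then have gt: "ennreal c < f x" if "x \<in> space M" for x
    using that by (simp add: not_le)
  then have "\<not> (AE x in M. f x \<le> ennreal c)"
    using AE_False by (auto simp: not_le[symmetric] cong: AE_cong)
  then have "(\<integral>\<^sup>+x. ennreal c \<partial>M) < (\<integral>\<^sup>+x. f x \<partial>M)"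
    using gt by (intro nn_integral_less) (auto simp: emeasure_space_1 less_imp_le)
  then show False
    using assms(2) by (simp add: emeasure_space_1 not_le[symmetric])
qed

lemma (in prob_space) exists_center_tail_le_if_subgaussian_difference:
  assumes [measurable]: "X \<in> borel_measurable M"
    and difference: "subgaussian (M \<Otimes>\<^sub>M M) v (\<lambda>(x, y). X y - X x)" and "v > 0" "t > 0"
  shows "\<exists>c. prob {x\<in>space M. t < \<bar>X x - c\<bar>} \<le> 2 * exp (- (t\<^sup>2 / (2 * v)))"
proof -
  define A where "A = {p\<in>space (M \<Otimes>\<^sub>M M). t < \<bar>X (snd p) - X (fst p)\<bar>}"
  have A_sets [measurable]: "A \<in> sets (M \<Otimes>\<^sub>M M)"
    unfolding A_def by measurable
  have "(\<integral>\<^sup>+x. emeasure M (Pair x -` A) \<partial>M) = emeasure (M \<Otimes>\<^sub>M M) A"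
    by (rule emeasure_pair_measure_alt[OF A_sets, symmetric])
  also have "\<dots> \<le> ennreal (2 * exp (- (t\<^sup>2 / (2 * v))))"
    using subgaussian_tail_abs[OF difference assms(3,4)] by (simp add: A_def case_prod_beta)
  finally obtain x where "x \<in> space M"
    and tail: "emeasure M (Pair x -` A) \<le> ennreal (2 * exp (- (t\<^sup>2 / (2 * v))))"
    using exists_le_of_nn_integral_le[OF measurable_emeasure_Pair[OF A_sets]] by blast
  have "Pair x -` A = {y\<in>space M. t < \<bar>X y - X x\<bar>}"
    using \<open>x \<in> space M\<close> by (auto simp: A_def space_pair_measure)
  then show ?thesis
    using tail by (auto simp: emeasure_eq_measure)
qed

lemma exp_increment_le_nn_integral:
  fixes g g' :: "real \<Rightarrow> real"
  assumes deriv: "\<And>t. (g has_real_derivative g' t) (at t)" and cont: "continuous_on UNIV g'"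
  shows "ennreal (exp (g 1 - g 0)) \<le> (\<integral>\<^sup>+t\<in>{0..1}. ennreal (exp (g' t)) \<partial>lborel)"
proof -
  \<comment> \<open>Jensen's inequality: \<open>exp\<close> lies above its tangent at the mean \<open>m\<close> of \<open>g'\<close>.\<close>
  define m where "m = g 1 - g 0"
  define tangent where "tangent t = exp m * (1 + g' t - m)" for t
  define G where "G t = exp m * (t + g t - m * t)" for t
  have isCont: "isCont g' t" for t
    using cont by (simp add: continuous_on_eq_continuous_at)
  have "(G has_real_derivative tangent t) (at t)" for t
    unfolding G_def tangent_def by (auto intro!: derivative_eq_intros deriv)
  moreover have "isCont tangent t" for t
    unfolding tangent_def by (intro continuous_intros isCont)
  moreover have "G 1 - G 0 = exp m"
    by (simp add: G_def m_def algebra_simps)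
  ultimately have tangent: "has_bochner_integral lborel (\<lambda>t. tangent t * indicator {0..1} t) (exp m)"
    using has_bochner_integral_FTC_Icc_real[of 0 1 G tangent] by simp
  have integrable: "integrable lborel (\<lambda>t. exp (g' t) * indicator {0..1} t)"
    using borel_integrable_atLeastAtMost[of 0 1 "\<lambda>t. exp (g' t)"] isCont by simp
  have "exp m = (\<integral>t. tangent t * indicator {0..1} t \<partial>lborel)"
    using tangent by (rule has_bochner_integral_integral_eq[symmetric])
  also have "\<dots> \<le> (\<integral>t. exp (g' t) * indicator {0..1} t \<partial>lborel)"
  proof (rule integral_mono[OF _ integrable])
    fix t
    have "tangent t \<le> exp (g' t)"
      using exp_ge_add_one_self[of "g' t - m"] by (simp add: tangent_def exp_diff field_simps)
    then show "tangent t * indicator {0..1} t \<le> exp (g' t) * indicator {0..1} t"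
      by (rule mult_right_mono) simp
  qed (use tangent in \<open>auto simp: has_bochner_integral_iff\<close>)
  finally have "ennreal (exp m) \<le> ennreal (\<integral>t. exp (g' t) * indicator {0..1} t \<partial>lborel)"
    by (rule ennreal_leI)
  also have "\<dots> = (\<integral>\<^sup>+t. ennreal (exp (g' t) * indicator {0..1} t) \<partial>lborel)"
    by (rule nn_integral_eq_integral[symmetric, OF integrable]) simp
  also have "\<dots> = (\<integral>\<^sup>+t\<in>{0..1}. ennreal (exp (g' t)) \<partial>lborel)"
    by (intro nn_integral_cong) (simp split: split_indicator)
  finally show ?thesis by (simp add: m_def)
qed

lemma (in sigma_finite_measure) subgaussian_increment:
  fixes X X' :: "real \<Rightarrow> 'a \<Rightarrow> real"
  assumes deriv: "\<And>t x. ((\<lambda>t. X t x) has_real_derivative X' t x) (at t)"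
    and cont: "\<And>x. continuous_on UNIV (\<lambda>t. X' t x)"
    and [measurable]: "X 0 \<in> borel_measurable M" "X 1 \<in> borel_measurable M"
      "(\<lambda>(t, x). X' t x) \<in> borel_measurable (lborel \<Otimes>\<^sub>M M)"
    and subgaussian_derivative: "\<And>t. subgaussian M v (X' t)"
  shows "subgaussian M v (\<lambda>x. X 1 x - X 0 x)"
proof (rule subgaussianI)
  fix l :: real
  interpret pair_sigma_finite lborel M ..
  let ?B = "ennreal (exp (v * l\<^sup>2 / 2))"
  have "((\<lambda>t. l * X t x) has_real_derivative l * X' t x) (at t)" for t x
    by (intro DERIV_cmult deriv)
  then have "(\<integral>\<^sup>+x. ennreal (exp (l * (X 1 x - X 0 x))) \<partial>M)
      \<le> (\<integral>\<^sup>+x. (\<integral>\<^sup>+t\<in>{0..1}. ennreal (exp (l * X' t x)) \<partial>lborel) \<partial>M)"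
    using exp_increment_le_nn_integral[of "\<lambda>t. l * X t _" "\<lambda>t. l * X' t _"] cont
    by (intro nn_integral_mono) (simp add: right_diff_distrib continuous_on_mult_left)
  also have "\<dots> = (\<integral>\<^sup>+t. (\<integral>\<^sup>+x. ennreal (exp (l * X' t x)) * indicator {0..1} t \<partial>M) \<partial>lborel)"
    by (rule Fubini') measurable
  also have "\<dots> = (\<integral>\<^sup>+t\<in>{0..1}. (\<integral>\<^sup>+x. ennreal (exp (l * X' t x)) \<partial>M) \<partial>lborel)"
    using borel_measurable_subgaussian[OF subgaussian_derivative]
    by (intro nn_integral_cong nn_integral_multc) measurable
  also have "\<dots> \<le> (\<integral>\<^sup>+t\<in>{0..1::real}. ?B \<partial>lborel)"
    by (intro nn_integral_mono mult_right_mono nn_integral_exp_subgaussian[OF subgaussian_derivative]) simp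
  also have "\<dots> = ?B"
    by (simp add: nn_integral_cmult)
  finally show "(\<integral>\<^sup>+x. ennreal (exp (l * (X 1 x - X 0 x))) \<partial>M) \<le> ?B" .
qed measurable

lemma cosh_le_exp_half_square: "cosh x \<le> exp (x\<^sup>2 / 2)" for x :: real
proof -
  have "cosh y \<le> exp (y\<^sup>2 / 2)" if "y \<ge> 0" for y :: real
  proof -
    have "- y + ln ((1 + exp (2 * y)) / 2) \<le> y\<^sup>2 / 2"
      using Hoeffdings_lemma_aux[of "2 * y" "1 / 2"] that
      by (simp add: power_mult_distrib field_simps)
    then have "exp (- y) * ((1 + exp (2 * y)) / 2) \<le> exp (y\<^sup>2 / 2)"
      by (subst (asm) exp_le_cancel_iff[symmetric])
         (simp only: exp_add exp_ln add_pos_pos exp_gt_zero zero_less_one half_gt_zero)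
    moreover have "exp (- y) * exp (2 * y) = exp y"
      by (simp flip: exp_add)
    ultimately show ?thesis
      by (simp add: cosh_field_def algebra_simps)
  qed
  from this[of "\<bar>x\<bar>"] show ?thesis by simp
qed

lemma sum_signs_exp_le:
  fixes x :: "'a \<Rightarrow> real"
  assumes "finite J"
  shows "(\<Sum>\<epsilon>\<in>J \<rightarrow>\<^sub>E {-1, 1}. exp (\<Sum>j\<in>J. \<epsilon> j * x j)) \<le> 2 ^ card J * exp ((\<Sum>j\<in>J. (x j)\<^sup>2) / 2)"
proof -
  have "(\<Sum>\<epsilon>\<in>J \<rightarrow>\<^sub>E {-1, 1}. exp (\<Sum>j\<in>J. \<epsilon> j * x j)) = (\<Prod>j\<in>J. \<Sum>s\<in>{-1, 1}. exp (s * x j))"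
    using assms by (simp add: exp_sum prod_sum_PiE del: insert_iff)
  also have "\<dots> = (\<Prod>j\<in>J. 2 * cosh (x j))"
    by (intro prod.cong refl) (simp add: cosh_field_def field_simps)
  also have "\<dots> \<le> (\<Prod>j\<in>J. 2 * exp ((x j)\<^sup>2 / 2))"
    by (intro prod_mono) (simp add: cosh_le_exp_half_square)
  also have "\<dots> = 2 ^ card J * exp ((\<Sum>j\<in>J. (x j)\<^sup>2) / 2)"
    using assms by (simp add: prod.distrib exp_sum sum_divide_distrib)
  finally show ?thesis .
qed

lemma (in prob_space) subgaussian_if_signed_sums:
  fixes J :: "'b set" and X :: "'a \<Rightarrow> real" and Z :: "'b \<Rightarrow> 'a \<Rightarrow> real"
  assumes J: "finite J" and X: "X \<in> borel_measurable M"
    and [measurable]: "\<And>j. j \<in> J \<Longrightarrow> Z j \<in> borel_measurable M"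
    and squares: "AE x in M. (\<Sum>j\<in>J. (Z j x)\<^sup>2) \<le> v"
    and mgf_eq: "\<And>\<epsilon> l. \<epsilon> \<in> J \<rightarrow>\<^sub>E {-1, 1} \<Longrightarrow>
      (\<integral>\<^sup>+x. ennreal (exp (l * X x)) \<partial>M) = (\<integral>\<^sup>+x. ennreal (exp (l * (\<Sum>j\<in>J. \<epsilon> j * Z j x))) \<partial>M)"
  shows "subgaussian M v X"
proof (rule subgaussianI[OF X])
  fix l
  let ?I = "\<integral>\<^sup>+x. ennreal (exp (l * X x)) \<partial>M" and ?B = "exp (v * l\<^sup>2 / 2)"
  have card_signs: "card (J \<rightarrow>\<^sub>E {-1, 1 :: real}) = 2 ^ card J"
    using J by (simp add: card_PiE numeral_2_eq_2)
  have "ennreal (2 ^ card J) * ?I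
      = (\<Sum>\<epsilon>\<in>J \<rightarrow>\<^sub>E {-1, 1}. \<integral>\<^sup>+x. ennreal (exp (l * (\<Sum>j\<in>J. \<epsilon> j * Z j x))) \<partial>M)"
    using card_signs by (simp add: mgf_eq[symmetric] ennreal_power[symmetric])
  also have "\<dots> = (\<integral>\<^sup>+x. ennreal (\<Sum>\<epsilon>\<in>J \<rightarrow>\<^sub>E {-1, 1}. exp (\<Sum>j\<in>J. \<epsilon> j * (l * Z j x))) \<partial>M)"
    by (subst nn_integral_sum[symmetric]) (auto simp: sum_distrib_left mult_ac)
  also have "\<dots> \<le> (\<integral>\<^sup>+x. ennreal (2 ^ card J * ?B) \<partial>M)"
  proof (intro nn_integral_mono_AE, use squares in eventually_elim)
    fix x assume sum_le: "(\<Sum>j\<in>J. (Z j x)\<^sup>2) \<le> v"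
    have "(\<Sum>j\<in>J. (l * Z j x)\<^sup>2) = (\<Sum>j\<in>J. (Z j x)\<^sup>2) * l\<^sup>2"
      by (simp add: power_mult_distrib sum_distrib_right mult.commute[of "l\<^sup>2"])
    also have "\<dots> \<le> v * l\<^sup>2"
      using sum_le by (intro mult_right_mono) auto
    finally have "2 ^ card J * exp ((\<Sum>j\<in>J. (l * Z j x)\<^sup>2) / 2) \<le> 2 ^ card J * ?B"
      by simp
    with sum_signs_exp_le[OF J, of "\<lambda>j. l * Z j x"]
    show "ennreal (\<Sum>\<epsilon>\<in>J \<rightarrow>\<^sub>E {-1, 1}. exp (\<Sum>j\<in>J. \<epsilon> j * (l * Z j x))) \<le> ennreal (2 ^ card J * ?B)"
      by (intro ennreal_leI) linarith
  qed
  also have "\<dots> = ennreal (2 ^ card J) * ennreal ?B"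
    by (simp add: emeasure_space_1 ennreal_mult)
  finally show "?I \<le> ennreal ?B"
    by (simp add: ennreal_mult_le_mult_iff)
qed

section \<open>Tail bounds without a prefactor\<close>

lemma exists_grid_interval:
  fixes z h :: real
  assumes "n \<ge> 1" "0 \<le> z" "z \<le> real n * h"
  shows "\<exists>i<n. real i * h \<le> z \<and> z \<le> real (Suc i) * h"
  using assms
proof (induction n rule: nat_induct_at_least)
  case base
  then show ?case by (intro exI[of _ 0]) auto
next
  case (Suc n)
  show ?case
  proof (cases "z \<le> real n * h")
    case True
    with Suc show ?thesis using less_SucI by blast
  next
    case False
    with Suc.prems show ?thesis by (intro exI[of _ n]) auto
  qed
qed

lemma (in finite_measure) exists_measure_le_card_mult_of_cover:
  assumes I: "finite I" "I \<noteq> {}" and B: "\<And>i. i \<in> I \<Longrightarrow> B i \<in> sets M" and cover: "A \<subseteq> (\<Union>i\<in>I. B i)"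
  shows "\<exists>i\<in>I. measure M A \<le> real (card I) * measure M (B i)"
proof (rule ccontr)
  assume "\<not> ?thesis"
  then have "(\<Sum>i\<in>I. measure M (B i)) < (\<Sum>i\<in>I. measure M A / real (card I))"
    using I by (intro sum_strict_mono) (auto simp: field_simps card_gt_0_iff)
  also have "\<dots> = measure M A"
    using I by simp
  also have "\<dots> \<le> measure M (\<Union>i\<in>I. B i)"
    using I B cover by (intro finite_measure_mono) auto
  also have "\<dots> \<le> (\<Sum>i\<in>I. measure M (B i))"
    using I B by (intro finite_measure_subadditive_finite) auto
  finally show False by simp
qed

lemma (in prob_space) exists_subinterval_prob_ge:
  assumes [measurable]: "X \<in> borel_measurable M" and n: "n \<ge> 1" and R: "R \<le> real n * r"
  shows "\<exists>c'. prob {x\<in>space M. \<bar>X x - c\<bar> \<le> R} \<le> real n * prob {x\<in>space M. \<bar>X x - c'\<bar> \<le> r}"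
proof -
  define center where "center i = c - real n * r + (2 * real i + 1) * r" for i
  have "{x\<in>space M. \<bar>X x - c\<bar> \<le> R} \<subseteq> (\<Union>i<n. {x\<in>space M. \<bar>X x - center i\<bar> \<le> r})"
  proof
    fix x assume x: "x \<in> {x\<in>space M. \<bar>X x - c\<bar> \<le> R}"
    then have "0 \<le> X x - c + real n * r" "X x - c + real n * r \<le> real n * (2 * r)"
      using R by (auto simp: abs_le_iff mult.commute[of r])
    from exists_grid_interval[OF n this] x
    show "x \<in> (\<Union>i<n. {x\<in>space M. \<bar>X x - center i\<bar> \<le> r})"
      by (auto simp: center_def algebra_simps abs_le_iff)
  qed
  then show ?thesis
    using exists_measure_le_card_mult_of_cover[of "{..<n}" "\<lambda>i. {x\<in>space M. \<bar>X x - center i\<bar> \<le> r}"] n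
    by (auto simp: lessThan_empty_iff)
qed

lemma (in prob_space) prob_abs_le_eq:
  fixes X :: "'a \<Rightarrow> real"
  assumes [measurable]: "X \<in> borel_measurable M"
  shows "prob {x\<in>space M. \<bar>X x - c\<bar> \<le> r} = 1 - prob {x\<in>space M. r < \<bar>X x - c\<bar>}"
proof -
  have "{x\<in>space M. r < \<bar>X x - c\<bar>} \<in> events" by measurable
  from prob_neg[OF this] show ?thesis by (simp add: not_less)
qed

lemma (in prob_space) exists_center_tail_le_if_half_mass:
  assumes X [measurable]: "X \<in> borel_measurable M" and "0 < t" "0 < R"
    and tail: "prob {x\<in>space M. R < \<bar>X x - c\<bar>} \<le> 1 / 2"
  shows "\<exists>c'. prob {x\<in>space M. t < \<bar>X x - c'\<bar>} \<le> 1 - 1 / (2 * (R / t + 1))"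
proof -
  define n where "n = nat \<lceil>R / t\<rceil>"
  have "R / t > 0" using \<open>0 < t\<close> \<open>0 < R\<close> by simp
  then have n: "n \<ge> 1" "R / t \<le> real n" "real n \<le> R / t + 1"
    using of_int_ceiling_le_add_one[of "R / t"] by (auto simp: n_def le_nat_iff Suc_le_eq of_nat_nat)
  have "1 / 2 \<le> prob {x\<in>space M. \<bar>X x - c\<bar> \<le> R}"
    using tail by (simp add: prob_abs_le_eq)
  also have "R \<le> real n * t"
    using n(2) \<open>0 < t\<close> by (simp add: field_simps)
  from exists_subinterval_prob_ge[OF X n(1) this]
  obtain c' where "prob {x\<in>space M. \<bar>X x - c\<bar> \<le> R} \<le> real n * prob {x\<in>space M. \<bar>X x - c'\<bar> \<le> t}"
    by blast
  finally have "1 / (2 * real n) \<le> prob {x\<in>space M. \<bar>X x - c'\<bar> \<le> t}"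
    using n(1) by (simp add: field_simps)
  moreover have "1 / (2 * (R / t + 1)) \<le> 1 / (2 * real n)"
    using n(1,3) by (intro divide_left_mono) auto
  ultimately show ?thesis
    by (intro exI[of _ c']) (simp add: prob_abs_le_eq)
qed

lemma two_mult_exp_minus_le: "2 * exp (- y) \<le> exp (- (y / 6))" if "1 \<le> y" for y :: real
proof -
  have "2 \<le> exp (5 / 6 :: real)"
    using exp_lower_Taylor_quadratic[of "5 / 6"] by (simp add: power2_eq_square)
  also have "\<dots> \<le> exp (y - y / 6)"
    using that by simp
  finally have "2 * exp (- y) \<le> exp (y - y / 6) * exp (- y)"
    by (rule mult_right_mono) simp
  then show ?thesis
    by (simp add: mult_exp_exp)
qed

lemma (in prob_space) exists_center_tail_le_without_prefactor:
  assumes X: "X \<in> borel_measurable M" and "a > 0" "t > 0"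
    and tail: "\<And>r. r > 0 \<Longrightarrow> \<exists>c. prob {x\<in>space M. r < \<bar>X x - c\<bar>} \<le> 2 * exp (- (a * r\<^sup>2))"
  shows "\<exists>c. prob {x\<in>space M. t < \<bar>X x - c\<bar>} \<le> exp (- (a * t\<^sup>2 / 6))"
proof (cases "1 \<le> a * t\<^sup>2")
  case True
  then show ?thesis
    using tail[OF \<open>t > 0\<close>] two_mult_exp_minus_le order_trans by blast
next
  case False
  define s where "s = sqrt a * t"
  have s_sq: "s\<^sup>2 = a * t\<^sup>2"
    using \<open>a > 0\<close> by (simp add: s_def power_mult_distrib)
  have "0 < s" using \<open>a > 0\<close> \<open>t > 0\<close> by (simp add: s_def)
  have "s < 1" using False s_sq power_less_one_iff[of s 2] \<open>0 < s\<close> by simp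
  define R where "R = 2 / sqrt a"
  have "R > 0" using \<open>a > 0\<close> by (simp add: R_def)
  have "a * R\<^sup>2 = 4" using \<open>a > 0\<close> by (simp add: R_def power_divide)
  then obtain c where "prob {x\<in>space M. R < \<bar>X x - c\<bar>} \<le> 2 * exp (- 4)"
    using tail[OF \<open>R > 0\<close>] by auto
  also have "\<dots> \<le> 1 / 2"
    using exp_ge_add_one_self[of 4] by (simp add: exp_minus field_simps)
  finally obtain c' where "prob {x\<in>space M. t < \<bar>X x - c'\<bar>} \<le> 1 - 1 / (2 * (R / t + 1))"
    using exists_center_tail_le_if_half_mass[OF X \<open>t > 0\<close> \<open>R > 0\<close>] by blast
  also have "R / t = 2 / s"
    by (simp add: R_def s_def)
  also have "1 - 1 / (2 * (2 / s + 1)) \<le> 1 + - (s\<^sup>2 / 6)"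
  proof -
    have "s\<^sup>2 * (2 * (2 / s + 1)) = 4 * s + 2 * s\<^sup>2"
      using \<open>0 < s\<close> by (simp add: field_simps power2_eq_square)
    also have "\<dots> \<le> 6"
      using \<open>0 < s\<close> \<open>s < 1\<close> power_le_one[of s 2] by simp
    finally have "s\<^sup>2 / 6 \<le> 1 / (2 * (2 / s + 1))"
      using \<open>0 < s\<close> by (simp add: pos_le_divide_eq add_pos_pos)
    then show ?thesis by simp
  qed
  also have "\<dots> \<le> exp (- (s\<^sup>2 / 6))"
    by (rule exp_ge_add_one_self)
  finally show ?thesis
    by (auto simp: s_sq)
qed

section \<open>Invariance of the Haar measure\<close>

lemma borel_measurable_matrix_mult [measurable]:
  fixes A :: "'a \<Rightarrow> complex^'n^'m" and B :: "'a \<Rightarrow> complex^'p^'n"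
  assumes "A \<in> borel_measurable M" "B \<in> borel_measurable M"
  shows "(\<lambda>x. A x ** B x) \<in> borel_measurable M"
  by (rule borel_measurable_continuous_Pair[OF assms])
     (unfold matrix_matrix_mult_def, intro continuous_intros)

lemma borel_measurable_matrix_vector_mult [measurable]:
  fixes A :: "'a \<Rightarrow> complex^'n^'m" and x :: "'a \<Rightarrow> complex^'n"
  assumes "A \<in> borel_measurable M" "x \<in> borel_measurable M"
  shows "(\<lambda>y. A y *v x y) \<in> borel_measurable M"
  by (rule borel_measurable_continuous_Pair[OF assms])
     (unfold matrix_vector_mult_def, intro continuous_intros)

lemma borel_measurable_cadj [measurable]:
  fixes A :: "'a \<Rightarrow> complex^'n^'n"
  assumes "A \<in> borel_measurable M"
  shows "(\<lambda>x. cadj (A x)) \<in> borel_measurable M"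
  by (rule measurable_compose[OF assms], rule borel_measurable_continuous_onI)
     (unfold cadj_def, intro continuous_intros)

locale haar =
  fixes \<mu> :: "(complex^'n^'n) measure"
  assumes haar: "haar_unitary \<mu>"
begin

sublocale prob_space \<mu>
  using haar by (simp add: haar_unitary_def)

sublocale pair: pair_prob_space \<mu> \<mu> ..

lemma sets_haar [simp, measurable_cong]: "sets \<mu> = sets borel"
  using haar by (simp add: haar_unitary_def)

lemma space_haar [simp]: "space \<mu> = UNIV"
  using sets_eq_imp_space_eq[OF sets_haar] by simp

lemma emeasure_haar_UNIV [simp]: "emeasure \<mu> UNIV = 1"
  using emeasure_space_1 by simp

lemma AE_unitary_mat: "AE U in \<mu>. unitary_mat U"
proof -
  have "prob {U. unitary_mat U} = 1"
    using haar by (simp add: haar_unitary_def)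
  from AE_prob_1[OF this] show ?thesis by simp
qed

lemma nn_integral_mult_left:
  assumes V: "unitary_mat V" and [measurable]: "F \<in> borel_measurable borel"
  shows "(\<integral>\<^sup>+U. F (V ** U) \<partial>\<mu>) = (\<integral>\<^sup>+U. F U \<partial>\<mu>)"
proof -
  have "distr \<mu> \<mu> (\<lambda>U. V ** U) = \<mu>"
    using haar V by (simp add: haar_unitary_def)
  then have "(\<integral>\<^sup>+U. F U \<partial>\<mu>) = (\<integral>\<^sup>+U. F U \<partial>(distr \<mu> \<mu> (\<lambda>U. V ** U)))"
    by simp
  also have "\<dots> = (\<integral>\<^sup>+U. F (V ** U) \<partial>\<mu>)"
    by (rule nn_integral_distr) measurable
  finally show ?thesis by simp
qed

text \<open>Both sides are the double integral of \<open>F (U\<^sup>* W)\<close>.\<close>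
lemma nn_integral_cadj:
  assumes [measurable]: "F \<in> borel_measurable borel"
  shows "(\<integral>\<^sup>+U. F (cadj U) \<partial>\<mu>) = (\<integral>\<^sup>+U. F U \<partial>\<mu>)"
proof -
  have "(\<integral>\<^sup>+U. F U \<partial>\<mu>) = (\<integral>\<^sup>+U. (\<integral>\<^sup>+W. F W \<partial>\<mu>) \<partial>\<mu>)"
    by simp
  also have "\<dots> = (\<integral>\<^sup>+U. (\<integral>\<^sup>+W. F (cadj U ** W) \<partial>\<mu>) \<partial>\<mu>)"
    by (intro nn_integral_cong_AE, use AE_unitary_mat in eventually_elim)
       (simp add: nn_integral_mult_left unitary_mat_cadj)
  also have "\<dots> = (\<integral>\<^sup>+W. (\<integral>\<^sup>+U. F (cadj U ** W) \<partial>\<mu>) \<partial>\<mu>)"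
    by (rule pair.Fubini') measurable
  also have "\<dots> = (\<integral>\<^sup>+W. (\<integral>\<^sup>+U. F (cadj U) \<partial>\<mu>) \<partial>\<mu>)"
  proof (intro nn_integral_cong_AE, use AE_unitary_mat in eventually_elim)
    fix W :: "complex^'n^'n" assume "unitary_mat W"
    then have "unitary_mat (cadj W)" by (rule unitary_mat_cadj)
    from nn_integral_mult_left[OF this, of "\<lambda>U. F (cadj U)"]
    show "(\<integral>\<^sup>+U. F (cadj U ** W) \<partial>\<mu>) = (\<integral>\<^sup>+U. F (cadj U) \<partial>\<mu>)"
      by (simp add: cadj_matrix_mult)
  qed
  finally show ?thesis
    by simp
qed

lemma nn_integral_mult_right:
  assumes V: "unitary_mat V" and [measurable]: "F \<in> borel_measurable borel"
  shows "(\<integral>\<^sup>+U. F (U ** V) \<partial>\<mu>) = (\<integral>\<^sup>+U. F U \<partial>\<mu>)"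
proof -
  have "(\<integral>\<^sup>+U. F (U ** V) \<partial>\<mu>) = (\<integral>\<^sup>+U. F (cadj (cadj V ** U)) \<partial>\<mu>)"
    using nn_integral_cadj[of "\<lambda>U. F (U ** V)"] by (simp add: cadj_matrix_mult)
  also have "\<dots> = (\<integral>\<^sup>+U. F (cadj U) \<partial>\<mu>)"
    using V by (intro nn_integral_mult_left[where F="\<lambda>U. F (cadj U)"] unitary_mat_cadj) measurable
  also have "\<dots> = (\<integral>\<^sup>+U. F U \<partial>\<mu>)"
    by (rule nn_integral_cadj) measurable
  finally show ?thesis .
qed

lemma nn_integral_pair_cong:
  fixes G :: "complex^'n \<Rightarrow> complex^'n \<Rightarrow> ennreal"
  assumes gram: "norm a = norm a'" "norm b = norm b'" "cinner a b = cinner a' b'"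
    and [measurable]: "(\<lambda>(x, y). G x y) \<in> borel_measurable (borel \<Otimes>\<^sub>M borel)"
  shows "(\<integral>\<^sup>+U. G (U *v a) (U *v b) \<partial>\<mu>) = (\<integral>\<^sup>+U. G (U *v a') (U *v b') \<partial>\<mu>)"
proof -
  obtain R where R: "unitary_mat R" "R *v a = a'" "R *v b = b'"
    using exists_unitary_map_pair[OF gram] .
  have "(\<integral>\<^sup>+U. G ((U ** R) *v a) ((U ** R) *v b) \<partial>\<mu>) = (\<integral>\<^sup>+U. G (U *v a) (U *v b) \<partial>\<mu>)"
    by (rule nn_integral_mult_right[OF R(1)]) measurable
  then show ?thesis
    using R(2,3) by (simp flip: matrix_vector_mul_assoc)
qed

end

section \<open>Concentration of phase-invariant functions\<close>

lemma sum_squares_orthonormal_le: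
  fixes \<phi> :: "'a::real_inner \<Rightarrow> real" and b :: "'i \<Rightarrow> 'a"
  assumes linear: "linear \<phi>" and bound: "\<And>x. \<bar>\<phi> x\<bar> \<le> L * norm x"
    and J: "finite J" and orthonormal: "\<And>i j. i \<in> J \<Longrightarrow> j \<in> J \<Longrightarrow> b i \<bullet> b j = (if i = j then 1 else 0)"
  shows "(\<Sum>j\<in>J. (\<phi> (b j))\<^sup>2) \<le> L\<^sup>2"
proof -
  define S where "S = (\<Sum>j\<in>J. (\<phi> (b j))\<^sup>2)"
  define x where "x = (\<Sum>j\<in>J. \<phi> (b j) *\<^sub>R b j)"
  have "S \<ge> 0" by (simp add: S_def sum_nonneg)
  have "(norm x)\<^sup>2 = (\<Sum>j\<in>J. (norm (\<phi> (b j) *\<^sub>R b j))\<^sup>2)"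
    unfolding x_def using J orthonormal
    by (intro norm_sum_Pythagorean) (auto simp: pairwise_def orthogonal_def)
  also have "\<dots> = S"
    using orthonormal by (simp add: S_def power_mult_distrib power2_norm_eq_inner)
  finally have norm_x: "(norm x)\<^sup>2 = S" .
  have "\<phi> x = S"
    by (simp add: x_def S_def linear_sum[OF linear] linear_scale[OF linear] power2_eq_square)
  then have "S\<^sup>2 \<le> (L * norm x)\<^sup>2"
    using bound[of x] by (simp add: abs_le_square_iff[symmetric] abs_le_iff)
  then have "S * S \<le> L\<^sup>2 * S"
    by (simp add: power_mult_distrib norm_x power2_eq_square[of S])
  then show ?thesis
    using \<open>S \<ge> 0\<close> by (cases "S = 0") (simp_all flip: S_def)
qed

lemma inner_axis_axis_complex: "axis i 1 \<bullet> (axis j 1 :: complex^'n) = (if i = j then 1 else 0)"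
  by (simp add: inner_axis_axis inner_complex_def)

lemma orthonormal_pair_axis_sum:
  fixes i :: "'n::finite" and c :: "'n \<Rightarrow> real"
  assumes "i \<notin> J" and "(\<Sum>j\<in>J. (c j)\<^sup>2) = 1"
  shows "orthonormal_pair (axis i 1) (\<Sum>j\<in>J. c j *\<^sub>R axis j 1)"
proof -
  let ?x = "\<Sum>j\<in>J. c j *\<^sub>R axis j 1 :: complex^'n"
  have "(norm ?x)\<^sup>2 = (\<Sum>j\<in>J. (norm (c j *\<^sub>R axis j 1 :: complex^'n))\<^sup>2)"
    by (intro norm_sum_Pythagorean) (auto simp: pairwise_def orthogonal_def inner_axis_axis_complex)
  then have "norm ?x = 1"
    using assms(2) by (simp add: norm_axis_complex abs_square_eq_1)
  moreover have "cinner (axis i 1) ?x = 0"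
    unfolding cinner_axis_left using assms(1) by (auto simp: axis_def intro!: sum.neutral)
  ultimately show ?thesis
    by (simp add: orthonormal_pair_def norm_axis_complex)
qed

locale phase_invariant_function =
  fixes f :: "complex^'n \<Rightarrow> real" and f' :: "complex^'n \<Rightarrow> complex^'n \<Rightarrow> real" and L :: real
  assumes has_derivative: "(f has_derivative f' v) (at v)"
    and continuous_derivative: "continuous_on UNIV (\<lambda>p. f' (fst p) (snd p))"
    and derivative_bound: "norm v = 1 \<Longrightarrow> \<bar>f' v h\<bar> \<le> L * norm h"
    and L_pos: "0 < L"
    and phase_invariant: "cmod c = 1 \<Longrightarrow> f (c *s v) = f v"
begin

lemma linear_derivative: "linear (f' v)"
  using has_derivative by (rule has_derivative_linear)

lemma borel_measurable_function [measurable]: "f \<in> borel_measurable borel"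
  using has_derivative has_derivative_continuous
  by (intro borel_measurable_continuous_onI continuous_at_imp_continuous_on) blast

lemma borel_measurable_derivative [measurable]:
  assumes "g \<in> borel_measurable M" "h \<in> borel_measurable M"
  shows "(\<lambda>x. f' (g x) (h x)) \<in> borel_measurable M"
  using borel_measurable_continuous_Pair[OF assms continuous_derivative] .

lemma has_real_derivative_along_curve:
  assumes "(\<gamma> has_vector_derivative \<gamma>') (at t)"
  shows "((\<lambda>t. f (U *v \<gamma> t)) has_real_derivative f' (U *v \<gamma> t) (U *v \<gamma>')) (at t)"
proof -
  have "bounded_linear (\<lambda>x. U *v x)"
    using matrix_vector_mul_linear linear_conv_bounded_linear by blast
  from bounded_linear.has_derivative[OF this] assms
  have "((\<lambda>t. U *v \<gamma> t) has_derivative (\<lambda>s. U *v (s *\<^sub>R \<gamma>'))) (at t)"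
    by (simp add: has_vector_derivative_def)
  from has_derivative_compose[OF this has_derivative]
  show ?thesis
    by (simp add: has_field_derivative_def linear_scale[OF matrix_vector_mul_linear]
        linear_scale[OF linear_derivative] mult_commute_abs)
qed

lemma sum_squares_derivative_le:
  assumes "unitary_mat U" "norm v = 1"
  shows "(\<Sum>j\<in>J. (f' (U *v v) (U *v axis j 1))\<^sup>2) \<le> L\<^sup>2"
proof (rule sum_squares_orthonormal_le[where b="\<lambda>j. axis j 1" and \<phi>="\<lambda>x. f' (U *v v) (U *v x)"])
  show "linear (\<lambda>x. f' (U *v v) (U *v x))"
    using linear_compose[OF matrix_vector_mul_linear linear_derivative] by (simp add: o_def)
  show "\<bar>f' (U *v v) (U *v x)\<bar> \<le> L * norm x" for x
    using derivative_bound[of "U *v v" "U *v x"] assms by (simp add: norm_unitary_mat)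
qed (simp_all add: inner_axis_axis_complex)

end

locale haar_phase_invariant = haar \<mu> + phase_invariant_function f f' L
  for \<mu> :: "(complex^'n^'n) measure" and f :: "complex^'n \<Rightarrow> real" and f' L
begin

text \<open>By invariance the direction \<open>b\<close> may be replaced by any \<open>(\<Sum>\<^sub>j \<plusminus>e\<^sub>j) / \<surd>(N - 1)\<close> orthogonal to the base
  point; averaging over the signs turns the derivative into a Rademacher sum.\<close>
lemma subgaussian_derivative:
  assumes "orthonormal_pair a b"
  shows "subgaussian \<mu> (L\<^sup>2 / (real CARD('n) - 1)) (\<lambda>U. f' (U *v a) (U *v b))"
proof -
  obtain i :: 'n where "i \<in> UNIV" by blast
  define J where "J = UNIV - {i}"
  have card_J: "real (card J) = real CARD('n) - 1" "card J > 0"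
    using card_ge_2_if_orthonormal_pair[OF assms] by (simp_all add: J_def card_Diff_singleton of_nat_diff)
  define r where "r = sqrt (card J)"
  have r_pos: "r > 0" and r_sq: "r\<^sup>2 = real CARD('n) - 1" using card_J by (simp_all add: r_def)
  define Z where "Z j U = f' (U *v axis i 1) (U *v axis j 1) / r" for j U
  have [measurable]: "Z j \<in> borel_measurable \<mu>" for j
    unfolding Z_def by measurable
  show ?thesis
  proof (rule subgaussian_if_signed_sums[where J=J and Z=Z])
    show "AE U in \<mu>. (\<Sum>j\<in>J. (Z j U)\<^sup>2) \<le> L\<^sup>2 / (real CARD('n) - 1)"
      using AE_unitary_mat
    proof eventually_elim
      fix U :: "complex^'n^'n" assume "unitary_mat U"
      from sum_squares_derivative_le[OF this norm_axis_complex, of i J]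
      show "(\<Sum>j\<in>J. (Z j U)\<^sup>2) \<le> L\<^sup>2 / (real CARD('n) - 1)"
        using r_pos r_sq by (simp add: Z_def power_divide divide_right_mono flip: sum_divide_distrib)
    qed
    fix \<epsilon> :: "'n \<Rightarrow> real" and l assume signs: "\<epsilon> \<in> J \<rightarrow>\<^sub>E {-1, 1}"
    define y where "y = (\<Sum>j\<in>J. (\<epsilon> j / r) *\<^sub>R axis j 1 :: complex^'n)"
    have "(\<epsilon> j / r)\<^sup>2 = 1 / card J" if "j \<in> J" for j
      using PiE_mem[OF signs that] r_sq card_J(1) by (auto simp: power_divide)
    then have "orthonormal_pair (axis i 1) y"
      unfolding y_def using card_J(2) by (intro orthonormal_pair_axis_sum) (auto simp: J_def)
    then have "(\<integral>\<^sup>+U. ennreal (exp (l * f' (U *v a) (U *v b))) \<partial>\<mu>)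
        = (\<integral>\<^sup>+U. ennreal (exp (l * f' (U *v axis i 1) (U *v y))) \<partial>\<mu>)"
      using assms unfolding orthonormal_pair_def by (intro nn_integral_pair_cong) auto
    moreover have "f' (U *v axis i 1) (U *v y) = (\<Sum>j\<in>J. \<epsilon> j * Z j U)" for U
      by (simp add: y_def Z_def linear_sum[OF matrix_vector_mul_linear]
          linear_scale[OF matrix_vector_mul_linear] linear_sum[OF linear_derivative]
          linear_scale[OF linear_derivative])
    ultimately show "(\<integral>\<^sup>+U. ennreal (exp (l * f' (U *v a) (U *v b))) \<partial>\<mu>)
        = (\<integral>\<^sup>+U. ennreal (exp (l * (\<Sum>j\<in>J. \<epsilon> j * Z j U))) \<partial>\<mu>)"
      by simp
  qed (simp_all add: J_def)
qed

lemma subgaussian_arc: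
  assumes "orthonormal_pair a b"
  shows "subgaussian \<mu> (\<alpha>\<^sup>2 * (L\<^sup>2 / (real CARD('n) - 1)))
    (\<lambda>U. f (U *v (cos \<alpha> *\<^sub>R a + sin \<alpha> *\<^sub>R b)) - f (U *v a))"
proof -
  define \<gamma> where "\<gamma> t = cos (\<alpha> * t) *\<^sub>R a + sin (\<alpha> * t) *\<^sub>R b" for t
  define \<delta> where "\<delta> t = cos (\<alpha> * t) *\<^sub>R b - sin (\<alpha> * t) *\<^sub>R a" for t
  have [measurable]: "\<gamma> \<in> borel_measurable borel" "\<delta> \<in> borel_measurable borel"
    unfolding \<gamma>_def \<delta>_def by (intro borel_measurable_continuous_onI continuous_intros)+
  have "subgaussian \<mu> (\<alpha>\<^sup>2 * (L\<^sup>2 / (real CARD('n) - 1))) (\<lambda>U. f (U *v \<gamma> 1) - f (U *v \<gamma> 0))"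
  proof (rule subgaussian_increment[of "\<lambda>t U. f (U *v \<gamma> t)" "\<lambda>t U. \<alpha> * f' (U *v \<gamma> t) (U *v \<delta> t)"])
    fix t and U :: "complex^'n^'n"
    have "(\<gamma> has_vector_derivative \<alpha> *\<^sub>R \<delta> t) (at t)"
      unfolding \<gamma>_def \<delta>_def by (auto intro!: derivative_eq_intros simp: algebra_simps)
    from has_real_derivative_along_curve[OF this, of U]
    show "((\<lambda>t. f (U *v \<gamma> t)) has_real_derivative \<alpha> * f' (U *v \<gamma> t) (U *v \<delta> t)) (at t)"
      by (simp add: linear_scale[OF matrix_vector_mul_linear] linear_scale[OF linear_derivative])
    have "continuous_on UNIV (\<lambda>t. (U *v \<gamma> t, U *v \<delta> t))"
      unfolding \<gamma>_def \<delta>_def matrix_vector_mult_def by (intro continuous_intros)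
    from continuous_on_compose2[OF continuous_derivative this]
    show "continuous_on UNIV (\<lambda>t. \<alpha> * f' (U *v \<gamma> t) (U *v \<delta> t))"
      by (intro continuous_on_mult_left) simp
    show "subgaussian \<mu> (\<alpha>\<^sup>2 * (L\<^sup>2 / (real CARD('n) - 1))) (\<lambda>U. \<alpha> * f' (U *v \<gamma> t) (U *v \<delta> t))"
      unfolding \<gamma>_def \<delta>_def
      by (intro subgaussian_cmult subgaussian_derivative orthonormal_pair_great_circle assms)
  qed measurable
  then show ?thesis
    by (simp add: \<gamma>_def)
qed

lemma subgaussian_difference:
  assumes "norm v = 1" "norm w = 1"
  shows "subgaussian \<mu> (pi\<^sup>2 * L\<^sup>2 / (2 * real CARD('n))) (\<lambda>U. f (U *v w) - f (U *v v))"
proof -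
  have f_phase: "f (U *v w) = f (U *v (c *s w))" if "cmod c = 1" for c U
    using phase_invariant[OF that] by (simp add: vector_scalar_commute)
  from assms show ?thesis
  proof (cases rule: exists_great_circle_through)
    case (phase c)
    then show ?thesis
      using f_phase subgaussian_zero by simp
  next
    case (arc c b \<alpha>)
    have card_ge_2: "real CARD('n) \<ge> 2"
      using card_ge_2_if_orthonormal_pair[OF arc(2)] by simp
    have "\<alpha>\<^sup>2 * (L\<^sup>2 / (real CARD('n) - 1)) \<le> (pi / 2)\<^sup>2 * (L\<^sup>2 / (real CARD('n) / 2))"
      using arc(3,4) card_ge_2 by (intro mult_mono power_mono divide_left_mono) auto
    also have "\<dots> = pi\<^sup>2 * L\<^sup>2 / (2 * real CARD('n))"
      by (simp add: power_divide)
    finally show ?thesis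
      using subgaussian_mono[OF subgaussian_arc[OF arc(2)]] arc(5) f_phase[OF arc(1)] by simp
  qed
qed

lemma subgaussian_independent_difference:
  assumes v: "norm v = 1"
  shows "subgaussian (\<mu> \<Otimes>\<^sub>M \<mu>) (pi\<^sup>2 * L\<^sup>2 / (2 * real CARD('n)))
    (\<lambda>(U, W). f (W *v v) - f (U *v v))"
proof (rule subgaussianI)
  fix l
  let ?B = "ennreal (exp (pi\<^sup>2 * L\<^sup>2 / (2 * real CARD('n)) * l\<^sup>2 / 2))"
  have "(\<integral>\<^sup>+p. ennreal (exp (l * (case p of (U, W) \<Rightarrow> f (W *v v) - f (U *v v)))) \<partial>(\<mu> \<Otimes>\<^sub>M \<mu>))
      = (\<integral>\<^sup>+U. (\<integral>\<^sup>+W. ennreal (exp (l * (f (W *v v) - f (U *v v)))) \<partial>\<mu>) \<partial>\<mu>)"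
    by (subst nn_integral_fst[symmetric]) auto
  also have "\<dots> = (\<integral>\<^sup>+U. (\<integral>\<^sup>+W. ennreal (exp (l * (f (U *v (W *v v)) - f (U *v v)))) \<partial>\<mu>) \<partial>\<mu>)"
  proof (intro nn_integral_cong_AE, use AE_unitary_mat in eventually_elim)
    fix U :: "complex^'n^'n" assume "unitary_mat U"
    from nn_integral_mult_left[OF this, of "\<lambda>W. ennreal (exp (l * (f (W *v v) - f (U *v v))))"]
    show "(\<integral>\<^sup>+W. ennreal (exp (l * (f (W *v v) - f (U *v v)))) \<partial>\<mu>)
        = (\<integral>\<^sup>+W. ennreal (exp (l * (f (U *v (W *v v)) - f (U *v v)))) \<partial>\<mu>)"
      by (simp add: matrix_vector_mul_assoc)
  qed
  also have "\<dots> = (\<integral>\<^sup>+W. (\<integral>\<^sup>+U. ennreal (exp (l * (f (U *v (W *v v)) - f (U *v v)))) \<partial>\<mu>) \<partial>\<mu>)"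
    by (rule pair.Fubini') measurable
  also have "\<dots> \<le> (\<integral>\<^sup>+W. ?B \<partial>\<mu>)"
  proof (intro nn_integral_mono_AE, use AE_unitary_mat in eventually_elim)
    fix W :: "complex^'n^'n" assume "unitary_mat W"
    then have "norm (W *v v) = 1" using v by (simp add: norm_unitary_mat)
    from nn_integral_exp_subgaussian[OF subgaussian_difference[OF v this]]
    show "(\<integral>\<^sup>+U. ennreal (exp (l * (f (U *v (W *v v)) - f (U *v v)))) \<partial>\<mu>) \<le> ?B" .
  qed
  also have "\<dots> = ?B"
    by simp
  finally show "(\<integral>\<^sup>+p. ennreal (exp (l * (case p of (U, W) \<Rightarrow> f (W *v v) - f (U *v v)))) \<partial>(\<mu> \<Otimes>\<^sub>M \<mu>)) \<le> ?B" .
qed measurable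

lemma exists_center_tail_le:
  assumes v: "norm v = 1" and t: "t > 0"
  shows "\<exists>c. prob {U. t < \<bar>f (U *v v) - c\<bar>} \<le> exp (- (real CARD('n) * t\<^sup>2 / (6 * pi\<^sup>2 * L\<^sup>2)))"
proof -
  define a where "a = real CARD('n) / (pi\<^sup>2 * L\<^sup>2)"
  have "a > 0" using L_pos by (simp add: a_def)
  have "\<exists>c. prob {U\<in>space \<mu>. r < \<bar>f (U *v v) - c\<bar>} \<le> 2 * exp (- (a * r\<^sup>2))" if "r > 0" for r
    using exists_center_tail_le_if_subgaussian_difference[OF _ subgaussian_independent_difference[OF v] _ that]
      L_pos by (simp add: a_def mult.commute)
  from exists_center_tail_le_without_prefactor[OF _ \<open>a > 0\<close> t this]
  show ?thesis by (simp add: a_def mult_ac)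
qed

end

section \<open>Expected values of observables\<close>

lemma finite_tidx [simp]: "finite (tidx k :: 'n::finite list set)"
  unfolding tidx_def using finite_lists_length_eq[of "UNIV :: 'n set" k] by simp

lemma sum_prod_tidx:
  fixes g :: "nat \<Rightarrow> 'n::finite \<Rightarrow> 'a::comm_semiring_1"
  shows "(\<Sum>xs\<in>tidx k. \<Prod>i<k. g i (xs ! i)) = (\<Prod>i<k. \<Sum>x\<in>UNIV. g i x)"
proof (induction k arbitrary: g)
  case 0
  have "tidx 0 = {[] :: 'n list}" by (auto simp: tidx_def)
  then show ?case by simp
next
  case (Suc k)
  have tidx_Suc: "tidx (Suc k) = (\<lambda>(x, xs). x # xs) ` ((UNIV :: 'n set) \<times> tidx k)"
    by (auto simp: tidx_def image_iff length_Suc_conv)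
  have "(\<Sum>xs\<in>tidx (Suc k). \<Prod>i<Suc k. g i (xs ! i))
      = (\<Sum>(x, xs)\<in>(UNIV :: 'n set) \<times> tidx k. g 0 x * (\<Prod>i<k. g (Suc i) (xs ! i)))"
    unfolding tidx_Suc
    by (subst sum.reindex)
       (auto simp: inj_on_def prod.lessThan_Suc_shift case_prod_beta simp del: prod.lessThan_Suc)
  also have "\<dots> = (\<Sum>x\<in>UNIV. g 0 x) * (\<Sum>xs\<in>tidx k. \<Prod>i<k. g (Suc i) (xs ! i))"
    by (simp add: sum_product sum.cartesian_product)
  also have "\<dots> = (\<Prod>i<Suc k. \<Sum>x\<in>UNIV. g i x)"
    unfolding Suc.IH[of "\<lambda>i. g (Suc i)"] by (simp add: prod.lessThan_Suc_shift del: prod.lessThan_Suc)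
  finally show ?case .
qed

definition tensor_norm :: "nat \<Rightarrow> ('n list \<Rightarrow> complex) \<Rightarrow> real" where
  "tensor_norm k a = L2_set (\<lambda>xs. cmod (a xs)) (tidx k)"

lemma tensor_norm_nonneg [simp]: "0 \<le> tensor_norm k a"
  by (simp add: tensor_norm_def)

lemma tensor_norm_sum_le:
  "tensor_norm k (\<lambda>xs. \<Sum>i\<in>I. a i xs) \<le> (\<Sum>i\<in>I. tensor_norm k (a i))"
proof (induction I rule: infinite_finite_induct)
  case (insert i I)
  have "tensor_norm k (\<lambda>xs. \<Sum>j\<in>insert i I. a j xs)
      \<le> L2_set (\<lambda>xs. cmod (a i xs) + cmod (\<Sum>j\<in>I. a j xs)) (tidx k)"
    unfolding tensor_norm_def using insert.hyps by (intro L2_set_mono) (auto intro: norm_triangle_ineq)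
  also have "\<dots> \<le> tensor_norm k (a i) + tensor_norm k (\<lambda>xs. \<Sum>j\<in>I. a j xs)"
    unfolding tensor_norm_def by (rule L2_set_triangle_ineq)
  finally show ?case using insert by simp
qed (simp_all add: tensor_norm_def L2_set_def)

lemma tensor_norm_product:
  fixes v :: "nat \<Rightarrow> complex^'n"
  shows "tensor_norm k (\<lambda>xs. \<Prod>i<k. v i $ (xs ! i)) = (\<Prod>i<k. norm (v i))"
proof -
  have "(tensor_norm k (\<lambda>xs. \<Prod>i<k. v i $ (xs ! i)))\<^sup>2
      = (\<Sum>xs\<in>tidx k. \<Prod>i<k. (cmod (v i $ (xs ! i)))\<^sup>2)"
    by (simp add: tensor_norm_def L2_set_def sum_nonneg prod_nonneg prod_power_distrib flip: prod_norm)
  also have "\<dots> = (\<Prod>i<k. \<Sum>x\<in>UNIV. (cmod (v i $ x))\<^sup>2)"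
    by (rule sum_prod_tidx)
  also have "\<dots> = (\<Prod>i<k. norm (v i))\<^sup>2"
    by (simp add: norm_vec_def L2_set_def sum_nonneg prod_power_distrib)
  finally show ?thesis
    by (simp add: prod_nonneg)
qed

definition matrix_element :: "nat \<Rightarrow> 'n kop \<Rightarrow> ('n list \<Rightarrow> complex) \<Rightarrow> ('n list \<Rightarrow> complex) \<Rightarrow> complex" where
  "matrix_element k Q a b = (\<Sum>xs\<in>tidx k. cnj (a xs) * apply_op k Q b xs)"

lemma cmod_matrix_element_le:
  assumes "Q \<in> obs k"
  shows "cmod (matrix_element k Q a b) \<le> tensor_norm k a * tensor_norm k b"
proof -
  have "cmod (matrix_element k Q a b) \<le> (\<Sum>xs\<in>tidx k. \<bar>cmod (a xs)\<bar> * \<bar>cmod (apply_op k Q b xs)\<bar>)"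
    unfolding matrix_element_def by (rule sum_norm_le) (simp add: norm_mult)
  also have "\<dots> \<le> tensor_norm k a * tensor_norm k (apply_op k Q b)"
    unfolding tensor_norm_def by (rule L2_set_mult_ineq)
  also have "tensor_norm k (apply_op k Q b) \<le> tensor_norm k b"
    using assms by (simp add: obs_def opnorm_le1_def tensor_norm_def L2_set_def)
  finally show ?thesis by (simp add: mult_left_mono)
qed

lemma cnj_matrix_element:
  assumes "hermitian_op k Q"
  shows "cnj (matrix_element k Q a b) = matrix_element k Q b a"
proof -
  have "cnj (Q xs ys) = Q ys xs" if "xs \<in> tidx k" "ys \<in> tidx k" for xs ys
    using assms that unfolding hermitian_op_def by (metis complex_cnj_cnj)
  then have "cnj (matrix_element k Q a b) = (\<Sum>xs\<in>tidx k. \<Sum>ys\<in>tidx k. cnj (b ys) * (Q ys xs * a xs))"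
    unfolding matrix_element_def apply_op_def
    by (simp add: sum_distrib_left mult_ac cong: sum.cong)
  also have "\<dots> = matrix_element k Q b a"
    unfolding matrix_element_def apply_op_def sum_distrib_left by (rule sum.swap)
  finally show ?thesis .
qed

definition tensor_vec :: "nat \<Rightarrow> complex^'n \<Rightarrow> 'n list \<Rightarrow> complex" where
  "tensor_vec k v xs = (\<Prod>i<k. v $ (xs ! i))"

definition tensor_vec_derivative :: "nat \<Rightarrow> complex^'n \<Rightarrow> complex^'n \<Rightarrow> 'n list \<Rightarrow> complex" where
  "tensor_vec_derivative k v h xs = (\<Sum>i<k. h $ (xs ! i) * (\<Prod>j\<in>{..<k} - {i}. v $ (xs ! j)))"

definition expected_value :: "nat \<Rightarrow> 'n kop \<Rightarrow> complex^'n \<Rightarrow> real" where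
  "expected_value k Q v = Re (matrix_element k Q (tensor_vec k v) (tensor_vec k v))"

definition expected_value_derivative :: "nat \<Rightarrow> 'n kop \<Rightarrow> complex^'n \<Rightarrow> complex^'n \<Rightarrow> real" where
  "expected_value_derivative k Q v h = Re (matrix_element k Q (tensor_vec_derivative k v h) (tensor_vec k v)
     + matrix_element k Q (tensor_vec k v) (tensor_vec_derivative k v h))"

lemma tensor_norm_tensor_vec: "tensor_norm k (tensor_vec k v) = norm v ^ k"
  using tensor_norm_product[of k "\<lambda>_. v"] by (simp add: tensor_vec_def[abs_def])

lemma tensor_norm_tensor_vec_derivative_le:
  assumes v: "norm v = 1"
  shows "tensor_norm k (tensor_vec_derivative k v h) \<le> real k * norm h"
proof -
  define slot where "slot i xs = h $ (xs ! i) * (\<Prod>j\<in>{..<k} - {i}. v $ (xs ! j))" for i xs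
  have norm_slot: "tensor_norm k (slot i) = norm h" if "i < k" for i
  proof -
    have "slot i = (\<lambda>xs. \<Prod>j<k. (if j = i then h else v) $ (xs ! j))"
      unfolding slot_def using that by (subst prod.remove[of _ i]) (auto intro!: ext prod.cong)
    moreover have "(\<Prod>j<k. norm (if j = i then h else v)) = norm h"
      using that v by (subst prod.remove[of _ i]) auto
    ultimately show ?thesis
      by (simp only: tensor_norm_product)
  qed
  have "tensor_vec_derivative k v h = (\<lambda>xs. \<Sum>i<k. slot i xs)"
    by (simp add: tensor_vec_derivative_def[abs_def] slot_def)
  then have "tensor_norm k (tensor_vec_derivative k v h) \<le> (\<Sum>i<k. tensor_norm k (slot i))"
    by (simp only: tensor_norm_sum_le)
  also have "\<dots> = real k * norm h"
    by (simp add: norm_slot)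
  finally show ?thesis .
qed

lemma has_derivative_tensor_vec:
  "((\<lambda>v. tensor_vec k v xs) has_derivative (\<lambda>h. tensor_vec_derivative k v h xs)) (at v)"
  unfolding tensor_vec_def tensor_vec_derivative_def
  by (intro has_derivative_prod bounded_linear_imp_has_derivative bounded_linear_vec_nth)

lemma has_derivative_expected_value:
  "(expected_value k Q has_derivative expected_value_derivative k Q v) (at v)"
proof -
  have "((\<lambda>v. \<Sum>xs\<in>tidx k. cnj (tensor_vec k v xs) * (\<Sum>ys\<in>tidx k. Q xs ys * tensor_vec k v ys))
      has_derivative
      (\<lambda>h. \<Sum>xs\<in>tidx k.
           cnj (tensor_vec k v xs) * (\<Sum>ys\<in>tidx k. Q xs ys * tensor_vec_derivative k v h ys)
         + cnj (tensor_vec_derivative k v h xs) * (\<Sum>ys\<in>tidx k. Q xs ys * tensor_vec k v ys))) (at v)"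
    by (intro has_derivative_sum has_derivative_mult has_derivative_mult_right has_derivative_cnj
        has_derivative_tensor_vec)
  from has_derivative_Re[OF this] show ?thesis
    unfolding expected_value_def[abs_def] expected_value_derivative_def[abs_def]
      matrix_element_def apply_op_def
    by (simp add: sum.distrib add.commute)
qed

lemma continuous_expected_value_derivative:
  "continuous_on UNIV (\<lambda>p. expected_value_derivative k Q (fst p) (snd p))"
  unfolding expected_value_derivative_def matrix_element_def apply_op_def tensor_vec_def
    tensor_vec_derivative_def
  by (intro continuous_intros)

lemma abs_expected_value_derivative_le:
  assumes Q: "Q \<in> obs k" and v: "norm v = 1"
  shows "\<bar>expected_value_derivative k Q v h\<bar> \<le> 2 * real k * norm h"
proof -
  let ?t = "tensor_vec k v" and ?d = "tensor_vec_derivative k v h"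
  have "\<bar>expected_value_derivative k Q v h\<bar>
      \<le> cmod (matrix_element k Q ?d ?t) + cmod (matrix_element k Q ?t ?d)"
    unfolding expected_value_derivative_def using abs_Re_le_cmod norm_triangle_ineq order_trans by blast
  also have "\<dots> \<le> tensor_norm k ?d * tensor_norm k ?t + tensor_norm k ?t * tensor_norm k ?d"
    by (intro add_mono cmod_matrix_element_le Q)
  also have "\<dots> \<le> 2 * real k * norm h"
    using tensor_norm_tensor_vec_derivative_le[OF v, of k h] v by (simp add: tensor_norm_tensor_vec)
  finally show ?thesis .
qed

lemma expected_value_phase:
  assumes c: "cmod c = 1"
  shows "expected_value k Q (c *s v) = expected_value k Q v"
proof -
  have tensor: "tensor_vec k (c *s v) = (\<lambda>xs. c ^ k * tensor_vec k v xs)"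
    by (simp add: tensor_vec_def[abs_def] prod.distrib)
  have "matrix_element k Q (tensor_vec k (c *s v)) (tensor_vec k (c *s v))
      = cnj (c ^ k) * c ^ k * matrix_element k Q (tensor_vec k v) (tensor_vec k v)"
    by (simp add: tensor matrix_element_def apply_op_def sum_distrib_left mult_ac)
  moreover have "cnj (c ^ k) * c ^ k = 1"
    using c by (simp add: mult.commute flip: complex_norm_square power_mult_distrib)
  ultimately show ?thesis
    by (simp add: expected_value_def)
qed

lemma tr_prod_tensor_pow_rho:
  assumes "Q \<in> obs k"
  shows "tr_prod k (tensor_pow k (rho i0 U)) Q = of_real (expected_value k Q (U *v axis i0 1))"
proof -
  let ?t = "tensor_vec k (U *v axis i0 1)"
  have "(U *v axis i0 1) $ i = U $ i $ i0" for i
    by (simp add: matrix_vector_mult_def axis_def if_distrib[of "\<lambda>x. _ * x"] cong: if_cong)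
  then have "tensor_pow k (rho i0 U) xs ys = ?t xs * cnj (?t ys)" for xs ys
    by (simp add: tensor_pow_def rho_def tensor_vec_def prod.distrib)
  then have "tr_prod k (tensor_pow k (rho i0 U)) Q
      = (\<Sum>xs\<in>tidx k. \<Sum>ys\<in>tidx k. cnj (?t ys) * (Q ys xs * ?t xs))"
    by (simp add: tr_prod_def mult_ac)
  also have "\<dots> = matrix_element k Q ?t ?t"
    unfolding matrix_element_def apply_op_def sum_distrib_left by (rule sum.swap)
  finally have "tr_prod k (tensor_pow k (rho i0 U)) Q = matrix_element k Q ?t ?t" .
  moreover have "matrix_element k Q ?t ?t \<in> \<real>"
    using assms by (simp add: Reals_cnj_iff cnj_matrix_element obs_def)
  ultimately show ?thesis
    by (simp add: expected_value_def)
qed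

lemma phase_invariant_function_expected_value:
  assumes "Q \<in> obs k" "k \<ge> 1"
  shows "phase_invariant_function (expected_value k Q) (expected_value_derivative k Q) (2 * real k)"
  using assms
  by unfold_locales
     (simp_all add: has_derivative_expected_value continuous_expected_value_derivative
        abs_expected_value_derivative_le expected_value_phase)

lemma (in haar) exists_center_tail_le_expected_value:
  assumes Q: "Q \<in> obs k" and k: "k \<ge> 1" and "\<tau> > 0"
  shows "\<exists>c. emeasure \<mu> {U. \<tau> < \<bar>expected_value k Q (U *v axis i0 1) - c\<bar>}
    \<le> ennreal (exp (- (real CARD('n) * \<tau>\<^sup>2 / (9 * pi ^ 3 * (real k)\<^sup>2))))"
proof -
  interpret haar_phase_invariant \<mu> "expected_value k Q" "expected_value_derivative k Q" "2 * real k"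
    using phase_invariant_function_expected_value[OF Q k]
    by (intro haar_phase_invariant.intro haar_axioms)
  have "6 * pi\<^sup>2 * (2 * real k)\<^sup>2 = 24 * (pi\<^sup>2 * (real k)\<^sup>2)"
    by (simp add: power_mult_distrib)
  also have "\<dots> \<le> 9 * pi * (pi\<^sup>2 * (real k)\<^sup>2)"
    using pi_approx by (intro mult_right_mono) auto
  also have "\<dots> = 9 * pi ^ 3 * (real k)\<^sup>2"
    by (simp add: power2_eq_square power3_eq_cube)
  finally have exponent: "real CARD('n) * \<tau>\<^sup>2 / (9 * pi ^ 3 * (real k)\<^sup>2)
      \<le> real CARD('n) * \<tau>\<^sup>2 / (6 * pi\<^sup>2 * (2 * real k)\<^sup>2)"
    using k by (intro divide_left_mono) auto
  obtain c where "prob {U. \<tau> < \<bar>expected_value k Q (U *v axis i0 1) - c\<bar>}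
      \<le> exp (- (real CARD('n) * \<tau>\<^sup>2 / (6 * pi\<^sup>2 * (2 * real k)\<^sup>2)))"
    using exists_center_tail_le[OF norm_axis_complex \<open>\<tau> > 0\<close>] by blast
  also have "\<dots> \<le> exp (- (real CARD('n) * \<tau>\<^sup>2 / (9 * pi ^ 3 * (real k)\<^sup>2)))"
    unfolding exp_le_cancel_iff neg_le_iff_le by (rule exponent)
  finally show ?thesis
    by (auto simp: emeasure_eq_measure)
qed

lemma ennreal_inverse_antimono: "a \<le> b \<Longrightarrow> inverse b \<le> inverse a" for a b :: ennreal
  including ennreal.lifting by transfer (rule ereal_inverse_antimono)

theorem mainTheorem11:
  fixes \<mu> :: "(complex^'n^'n) measure" and i0 :: 'n and k :: nat and \<tau> :: real
  assumes "haar_unitary \<mu>" and "k \<ge> 1" and "\<tau> > 0"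
  shows "ennreal (exp (real CARD('n) * \<tau>\<^sup>2 / (9 * pi ^ 3 * (real k)\<^sup>2))) \<le> q_nt \<mu> i0 k \<tau>"
proof -
  interpret haar \<mu> using assms(1) by unfold_locales
  let ?c = "real CARD('n) * \<tau>\<^sup>2 / (9 * pi ^ 3 * (real k)\<^sup>2)"
  let ?p = "\<lambda>g Q. emeasure \<mu> {U\<in>space \<mu>.
    cmod (tr_prod k (tensor_pow k (rho i0 U)) Q - complex_of_real (g Q)) > \<tau>}"
  have "\<forall>Q\<in>obs k. \<exists>c. emeasure \<mu> {U. \<tau> < \<bar>expected_value k Q (U *v axis i0 1) - c\<bar>} \<le> ennreal (exp (- ?c))"
    using exists_center_tail_le_expected_value[OF _ assms(2,3)] by blast
  then obtain g where "\<And>Q. Q \<in> obs k \<Longrightarrow>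
      emeasure \<mu> {U. \<tau> < \<bar>expected_value k Q (U *v axis i0 1) - g Q\<bar>} \<le> ennreal (exp (- ?c))"
    by metis
  then have "(SUP Q\<in>obs k. ?p g Q) \<le> ennreal (exp (- ?c))"
    by (intro SUP_least) (simp add: tr_prod_tensor_pow_rho flip: of_real_diff)
  then have "inverse (ennreal (exp (- ?c))) \<le> inverse (SUP Q\<in>obs k. ?p g Q)"
    by (rule ennreal_inverse_antimono)
  also have "\<dots> \<le> q_nt \<mu> i0 k \<tau>"
    unfolding q_nt_def by (rule SUP_upper) simp
  finally show ?thesis by (simp add: inverse_ennreal exp_minus)
qed

end
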